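(* Let $D=(V,A)$ be a digraph with nonnegative edge weights and $2\le k\le|V|$, and let $\{x^v_i\},\{y^e_{ij}\}$ be an optimal solution to the LP: maximize $\sum_{e\in A}w(e)\sum_{i<j}y^e_{ij}$ subject to $\sum_{i\in[k]}x^v_i=1$ for all $v\in V$; for each $e=(u,v)\in A$ and $i,j\in[k]$, $\sum_{\ell\in[k]}y^e_{i\ell}=x^u_i$ and $\sum_{\ell\in[k]}y^e_{\ell j}=x^v_j$; $x^v_i\ge0$, $y^e_{ij}\ge0$. Let $\ell:V\to[k]$ be the random labeling obtained by independently assigning to each vertex $v$ the label $i$ with probability $\frac{1}{2k}+\frac{x^v_i}{2}$. Then for every edge $e=(u,v)\in A$, $$\Pr[\ell(u)<\ell(v)]\ \ge\ \frac12\sum_{i,j\in[k],\,i<j}y^e_{ij}.$$ *)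

theory Defs
  imports "HOL-Probability.Probability" "Graph_Theory.Digraph"
begin

text \<open>
  The label set [k] is \<open>{1..k}\<close>. The values of \<open>x\<close> and \<open>y\<close> at vertices, arcs or labels
  outside their index sets are irrelevant to all three definitions. The locale \<open>digraph\<close> of
  the graph library stands for a finite digraph without loops and without parallel arcs; for
  an arc \<open>e = (u, v)\<close>, \<open>u = tail D e\<close> and \<open>v = head D e\<close>.
\<close>

definition lp_feasible ::
  "('a, 'b) pre_digraph \<Rightarrow> nat \<Rightarrow> ('a \<Rightarrow> nat \<Rightarrow> real) \<Rightarrow> ('b \<Rightarrow> nat \<Rightarrow> nat \<Rightarrow> real) \<Rightarrow> bool" where
  "lp_feasible D k x y \<longleftrightarrow>
     (\<forall>v\<in>verts D. (\<Sum>i\<in>{1..k}. x v i) = 1) \<and>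
     (\<forall>e\<in>arcs D. \<forall>i\<in>{1..k}. (\<Sum>l\<in>{1..k}. y e i l) = x (tail D e) i) \<and>
     (\<forall>e\<in>arcs D. \<forall>j\<in>{1..k}. (\<Sum>l\<in>{1..k}. y e l j) = x (head D e) j) \<and>
     (\<forall>v\<in>verts D. \<forall>i\<in>{1..k}. 0 \<le> x v i) \<and>
     (\<forall>e\<in>arcs D. \<forall>i\<in>{1..k}. \<forall>j\<in>{1..k}. 0 \<le> y e i j)"

definition lp_objective ::
  "('a, 'b) pre_digraph \<Rightarrow> ('b \<Rightarrow> real) \<Rightarrow> nat \<Rightarrow> ('b \<Rightarrow> nat \<Rightarrow> nat \<Rightarrow> real) \<Rightarrow> real" where
  "lp_objective D w k y =
     (\<Sum>e\<in>arcs D. w e * (\<Sum>(i, j)\<in>{(i, j). i \<in> {1..k} \<and> j \<in> {1..k} \<and> i < j}. y e i j))"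

definition lp_optimal ::
  "('a, 'b) pre_digraph \<Rightarrow> ('b \<Rightarrow> real) \<Rightarrow> nat \<Rightarrow>
     ('a \<Rightarrow> nat \<Rightarrow> real) \<Rightarrow> ('b \<Rightarrow> nat \<Rightarrow> nat \<Rightarrow> real) \<Rightarrow> bool" where
  "lp_optimal D w k x y \<longleftrightarrow>
     lp_feasible D k x y \<and>
     (\<forall>x' y'. lp_feasible D k x' y' \<longrightarrow> lp_objective D w k y' \<le> lp_objective D w k y)"

end

theory Submission
  imports Defs
begin

text \<open>
  Fix an arc and put \<open>a i = x u i\<close>, \<open>b j = x v j\<close>, with partial sums \<open>F\<close> and \<open>G\<close>, and let
  \<open>s\<close> be the mass that \<open>y\<close> puts on pairs \<open>i < j\<close>. As \<open>y\<close> is a coupling of \<open>a\<close> and \<open>b\<close>,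
  a pair \<open>i < l\<close> has \<open>i < j\<close> or \<open>l > j\<close> for each fixed \<open>j\<close>, so that
  \<open>s \<le> F (j - 1) + 1 - G j\<close>. With \<open>c j = 1 / k + b j\<close> and \<open>H\<close> its partial sums (\<open>H k = 2\<close>), the
  probability in question is \<open>1 / 4\<close> times
  \<open>(\<Sum>j. c j * ((j - 1) / k + F (j - 1))) \<ge> (\<Sum>j. c j * (H j - 1 / k - 1 + s))\<close>. Since
  \<open>2 * (\<Sum>j. c j * H j) = (\<Sum>j. c j)\<^sup>2 + (\<Sum>j. (c j)\<^sup>2) \<ge> 4 + 4 / k\<close>, the right-hand side
  is at least \<open>2 * s\<close>.
\<close>

text \<open>Bridges the index set of the LP objective and iterated sums with the larger label
  outside, where the inner sums become partial sums.\<close>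

lemma sum_less_pairs:
  fixes f :: "nat \<Rightarrow> nat \<Rightarrow> 'c::comm_monoid_add"
  shows "(\<Sum>(i, j)\<in>{(i, j). i \<in> {1..k} \<and> j \<in> {1..k} \<and> i < j}. f i j) =
           (\<Sum>j\<in>{1..k}. \<Sum>i\<in>{1..<j}. f i j)"
proof -
  have "(\<Sum>j\<in>{1..k}. \<Sum>i\<in>{1..<j}. f i j) = (\<Sum>(j, i)\<in>(SIGMA j:{1..k}. {1..<j}). f i j)"
    by (simp add: sum.Sigma)
  also have "\<dots> = (\<Sum>(i, j)\<in>{(i, j). i \<in> {1..k} \<and> j \<in> {1..k} \<and> i < j}. f i j)"
    by (rule sum.reindex_bij_witness[of _ prod.swap prod.swap]) auto
  finally show ?thesis ..
qed

text \<open>The left side runs twice over the pairs \<open>i \<le> j\<close>, whereas the square has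
  each off-diagonal product twice but the diagonal only once; the sum of squares supplies the
  missing diagonal.\<close>

lemma sum_mult_partial_sum:
  fixes c :: "nat \<Rightarrow> 'c::comm_ring_1"
  shows "2 * (\<Sum>j\<in>{1..n}. c j * sum c {1..j}) = (sum c {1..n})\<^sup>2 + (\<Sum>j\<in>{1..n}. (c j)\<^sup>2)"
  by (induction n) (simp_all add: power2_eq_square algebra_simps)

lemma sum_squares_ge_mean:
  fixes c :: "'c \<Rightarrow> real"
  assumes "finite A" and "A \<noteq> {}"
  shows "(sum c A)\<^sup>2 / real (card A) \<le> (\<Sum>j\<in>A. (c j)\<^sup>2)"
  using sum_squared_le_sum_of_squares[of c A] assms
  by (simp add: divide_le_eq mult.commute card_gt_0_iff)

lemma coupling_less_mass_le:
  fixes z :: "nat \<Rightarrow> nat \<Rightarrow> real"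
  assumes nonneg: "\<And>i l. i \<in> {1..k} \<Longrightarrow> l \<in> {1..k} \<Longrightarrow> 0 \<le> z i l"
    and a: "\<And>i. i \<in> {1..k} \<Longrightarrow> (\<Sum>l\<in>{1..k}. z i l) = a i"
    and b: "\<And>l. l \<in> {1..k} \<Longrightarrow> (\<Sum>i\<in>{1..k}. z i l) = b l"
    and j: "j \<in> {1..k}"
  shows "(\<Sum>l\<in>{1..k}. \<Sum>i\<in>{1..<l}. z i l) \<le> sum a {1..<j} + sum b {j<..k}"
proof -
  have "(\<Sum>l\<in>{1..k}. \<Sum>i\<in>{1..<l}. z i l) = (\<Sum>l\<in>{1..k}. \<Sum>i\<in>{1..k}. if i < l then z i l else 0)"
  proof (rule sum.cong[OF refl])
    fix l assume "l \<in> {1..k}"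
    then have "{1..<l} = {1..k} \<inter> {i. i < l}" by auto
    then show "(\<Sum>i\<in>{1..<l}. z i l) = (\<Sum>i\<in>{1..k}. if i < l then z i l else 0)"
      by (simp only: sum.inter_restrict[OF finite_atLeastAtMost] mem_Collect_eq)
  qed
  \<comment> \<open>If neither \<open>i < j\<close> nor \<open>j < l\<close>, then
    \<open>l \<le> j \<le> i\<close>, which excludes \<open>i < l\<close>. Pairs meeting both
    conditions are counted twice, which nonnegativity allows.\<close>
  also have "\<dots> \<le> (\<Sum>l\<in>{1..k}. \<Sum>i\<in>{1..k}.
                     (if i < j then z i l else 0) + (if j < l then z i l else 0))"
    using nonneg by (intro sum_mono) auto
  \<comment> \<open>Only the first half is swapped: its condition on \<open>i\<close> calls for full
    row sums, the other for full column sums.\<close>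
  also have "\<dots> = (\<Sum>i\<in>{1..k}. \<Sum>l\<in>{1..k}. if i < j then z i l else 0) +
                  (\<Sum>l\<in>{1..k}. \<Sum>i\<in>{1..k}. if j < l then z i l else 0)"
    by (simp only: sum.distrib
          sum.swap[where g = "\<lambda>l i. if i < j then z i l else 0"])
  also have "(\<Sum>i\<in>{1..k}. \<Sum>l\<in>{1..k}. if i < j then z i l else 0) =
             (\<Sum>i\<in>{1..k}. if i < j then a i else 0)"
    using a by (intro sum.cong) auto
  also have "\<dots> = sum a {1..<j}"
  proof -
    have "{1..<j} = {1..k} \<inter> {i. i < j}" using j by auto
    then show ?thesis by (simp only: sum.inter_restrict[OF finite_atLeastAtMost] mem_Collect_eq)
  qed
  also have "(\<Sum>l\<in>{1..k}. \<Sum>i\<in>{1..k}. if j < l then z i l else 0) =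
             (\<Sum>l\<in>{1..k}. if j < l then b l else 0)"
    using b by (intro sum.cong) auto
  also have "\<dots> = sum b {j<..k}"
  proof -
    have "{j<..k} = {1..k} \<inter> {i. j < i}" using j by auto
    then show ?thesis by (simp only: sum.inter_restrict[OF finite_atLeastAtMost] mem_Collect_eq)
  qed
  finally show ?thesis .
qed

lemma rounded_less_mass_ge:
  fixes z :: "nat \<Rightarrow> nat \<Rightarrow> real"
  assumes nonneg: "\<And>i l. i \<in> {1..k} \<Longrightarrow> l \<in> {1..k} \<Longrightarrow> 0 \<le> z i l"
    and a: "\<And>i. i \<in> {1..k} \<Longrightarrow> (\<Sum>l\<in>{1..k}. z i l) = a i"
    and b: "\<And>l. l \<in> {1..k} \<Longrightarrow> (\<Sum>i\<in>{1..k}. z i l) = b l"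
    and b1: "sum b {1..k} = 1" and "1 \<le> k"
  shows "1 / 2 * (\<Sum>j\<in>{1..k}. \<Sum>i\<in>{1..<j}. z i j) \<le>
         (\<Sum>j\<in>{1..k}. \<Sum>i\<in>{1..<j}. (1 / (2 * real k) + a i / 2) * (1 / (2 * real k) + b j / 2))"
    (is "1 / 2 * ?s \<le> ?P")
proof -
  \<comment> \<open>Twice the probability of label \<open>j\<close> at the head. Doubling both
    factors accounts for the \<open>4 * ?P\<close> at the end of the chain.\<close>
  define c where "c j = 1 / real k + b j" for j
  have c_nonneg: "0 \<le> c j" if "j \<in> {1..k}" for j
    using that nonneg by (auto simp: c_def b[symmetric] intro!: add_nonneg_nonneg sum_nonneg)
  have c_sum: "sum c {1..k} = 2"
    using b1 \<open>1 \<le> k\<close> by (simp add: c_def sum.distrib)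
  have "4 / real k \<le> (\<Sum>j\<in>{1..k}. (c j)\<^sup>2)"
    using sum_squares_ge_mean[of "{1..k}" c] \<open>1 \<le> k\<close> c_sum by simp
  then have "2 * (\<Sum>j\<in>{1..k}. c j * sum c {1..j}) \<ge> 4 + 4 / real k"
    unfolding sum_mult_partial_sum c_sum by simp
  \<comment> \<open>The constants cancel exactly: half of \<open>4 + 4 / k\<close>, minus the total
    mass 2 times \<open>1 / k + 1 - ?s\<close>, is \<open>2 * ?s\<close>.\<close>
  then have "2 * ?s \<le> (\<Sum>j\<in>{1..k}. c j * sum c {1..j}) - (\<Sum>j\<in>{1..k}. c j) * (1 / real k + 1 - ?s)"
    unfolding c_sum by (simp add: algebra_simps)
  also have "\<dots> = (\<Sum>j\<in>{1..k}. c j * (sum c {1..j} - (1 / real k + 1 - ?s)))"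
    by (simp only: sum_distrib_right sum_subtractf right_diff_distrib)
  also have "\<dots> \<le> (\<Sum>j\<in>{1..k}. c j * (\<Sum>i\<in>{1..<j}. 1 / real k + a i))"
  proof (intro sum_mono mult_left_mono c_nonneg)
    fix j assume j: "j \<in> {1..k}"
    have "sum b {1..j} + sum b {j<..k} = 1"
    proof -
      have "{1..k} = {1..j} \<union> {j<..k}" using j by auto
      then show ?thesis using b1 by (simp add: sum.union_disjoint[symmetric] ivl_disj_int)
    qed
    moreover have "?s \<le> sum a {1..<j} + sum b {j<..k}"
      using nonneg a b j by (rule coupling_less_mass_le)
    ultimately have "sum b {1..j} \<le> sum a {1..<j} + 1 - ?s" by linarith
    \<comment> \<open>\<open>sum c {1..j}\<close> has \<open>j\<close> uniform terms, the sum over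
      \<open>{1..<j}\<close> one fewer; the \<open>1 / k\<close> in the subtracted constant makes up
      for it.\<close>
    moreover have "real j / real k = (real j - 1) / real k + 1 / real k"
      by (simp add: diff_divide_distrib)
    ultimately show "sum c {1..j} - (1 / real k + 1 - ?s) \<le> (\<Sum>i\<in>{1..<j}. 1 / real k + a i)"
      using j by (simp add: c_def sum.distrib of_nat_diff)
  qed
  also have "\<dots> = 4 * ?P"
    unfolding c_def sum_distrib_left using \<open>1 \<le> k\<close>
    by (intro sum.cong refl) (simp add: field_simps)
  finally show ?thesis by simp
qed

lemma (in prob_space) prob_less_indep_vars:
  fixes L :: "'v \<Rightarrow> 'a \<Rightarrow> nat"
  assumes indep: "indep_vars (\<lambda>_. count_space {1..k}) L V"
    and "u \<in> V" and "v \<in> V" and "u \<noteq> v"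
  shows "prob {\<omega> \<in> space M. L u \<omega> < L v \<omega>} =
         (\<Sum>j\<in>{1..k}. \<Sum>i\<in>{1..<j}. prob {\<omega> \<in> space M. L u \<omega> = i} * prob {\<omega> \<in> space M. L v \<omega> = j})"
proof -
  have meas: "random_variable (count_space {1..k}) (L t)" if "t \<in> V" for t
    using indep that by (simp add: indep_vars_def2)
  \<comment> \<open>Measurability into \<open>count_space {1..k}\<close> already confines the labels
    to \<open>{1..k}\<close> at every point of \<open>space M\<close>.\<close>
  have range: "L t \<omega> \<in> {1..k}" if "t \<in> V" "\<omega> \<in> space M" for t \<omega>
    using measurable_space[OF meas[OF that(1)] that(2)] by simp
  define E where "E = (\<lambda>(i, j). {\<omega> \<in> space M. L u \<omega> = i \<and> L v \<omega> = j})"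
  let ?I = "{(i, j). i \<in> {1..k} \<and> j \<in> {1..k} \<and> i < j}"
  have fin: "finite ?I"
    by (rule finite_subset[of _ "{1..k} \<times> {1..k}"]) auto
  have event: "{\<omega> \<in> space M. L t \<omega> = i} = L t -` {i} \<inter> space M" for t i
    by auto
  have ev: "{\<omega> \<in> space M. L t \<omega> = i} \<in> events" if "t \<in> V" "i \<in> {1..k}" for t i
    unfolding event using meas[OF that(1)] that(2) by (intro measurable_sets) auto
  have E_ev: "E (i, j) \<in> events" if "i \<in> {1..k}" "j \<in> {1..k}" for i j
  proof -
    have "E (i, j) = {\<omega> \<in> space M. L u \<omega> = i} \<inter> {\<omega> \<in> space M. L v \<omega> = j}"
      by (auto simp: E_def)
    then show ?thesis using ev[OF \<open>u \<in> V\<close> that(1)] ev[OF \<open>v \<in> V\<close> that(2)] by simp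
  qed
  have "{\<omega> \<in> space M. L u \<omega> < L v \<omega>} = (\<Union>p\<in>?I. E p)"
    using range[OF \<open>u \<in> V\<close>] range[OF \<open>v \<in> V\<close>] by (auto simp: E_def)
  also have "prob \<dots> = (\<Sum>p\<in>?I. prob (E p))"
    using fin E_ev
    by (intro finite_measure_finite_Union) (auto simp: disjoint_family_on_def E_def)
  also have "\<dots> = (\<Sum>(i, j)\<in>?I. prob {\<omega> \<in> space M. L u \<omega> = i} * prob {\<omega> \<in> space M. L v \<omega> = j})"
  proof (intro sum.cong refl, clarify)
    fix i j assume "i \<in> {1..k}" "j \<in> {1..k}"
    \<comment> \<open>Independence is applied to a family of sets indexed by vertices; the
      \<open>if\<close> encodes the two events, consistently because
      \<open>u \<noteq> v\<close>.\<close>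
    then have "prob (\<Inter>t\<in>{u, v}. L t -` (if t = u then {i} else {j}) \<inter> space M) =
               (\<Prod>t\<in>{u, v}. prob (L t -` (if t = u then {i} else {j}) \<inter> space M))"
      using assms by (intro indep_varsD[OF indep]) auto
    moreover have "(\<Inter>t\<in>{u, v}. L t -` (if t = u then {i} else {j}) \<inter> space M) = E (i, j)"
      using \<open>u \<noteq> v\<close> by (auto simp: E_def)
    ultimately show "prob (E (i, j)) =
        prob {\<omega> \<in> space M. L u \<omega> = i} * prob {\<omega> \<in> space M. L v \<omega> = j}"
      using \<open>u \<noteq> v\<close> by (simp add: event)
  qed
  finally show ?thesis by (simp only: sum_less_pairs)
qed

theorem theorem5:
  fixes D :: "('a, 'b) pre_digraph"
    and w :: "'b \<Rightarrow> real"
    and k :: nat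
    and x :: "'a \<Rightarrow> nat \<Rightarrow> real"
    and y :: "'b \<Rightarrow> nat \<Rightarrow> nat \<Rightarrow> real"
    and M :: "'s measure"
    and L :: "'a \<Rightarrow> 's \<Rightarrow> nat"
  assumes "digraph D"
    and "\<And>e. e \<in> arcs D \<Longrightarrow> 0 \<le> w e"
    and "2 \<le> k" and "k \<le> card (verts D)"
    and "lp_optimal D w k x y"
    and "prob_space M"
    and "prob_space.indep_vars M (\<lambda>_. count_space {1..k}) L (verts D)"
    and "\<And>v i. v \<in> verts D \<Longrightarrow> i \<in> {1..k} \<Longrightarrow>
           measure M {\<omega> \<in> space M. L v \<omega> = i} = 1 / (2 * real k) + x v i / 2"
  shows "\<forall>e\<in>arcs D.
           measure M {\<omega> \<in> space M. L (tail D e) \<omega> < L (head D e) \<omega>}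
             \<ge> 1 / 2 * (\<Sum>(i, j)\<in>{(i, j). i \<in> {1..k} \<and> j \<in> {1..k} \<and> i < j}. y e i j)"
proof
  interpret digraph D by fact
  interpret prob_space M by fact
  fix e assume e: "e \<in> arcs D"
  define u v where "u = tail D e" and "v = head D e"
  \<comment> \<open>The absence of loops makes the endpoints distinct, so independence applies to
    their labels.\<close>
  have uv: "u \<in> verts D" "v \<in> verts D" "u \<noteq> v"
    using e no_loops by (auto simp: u_def v_def)
  have feas: "lp_feasible D k x y"
    using assms(5) by (simp add: lp_optimal_def)
  have "1 / 2 * (\<Sum>j\<in>{1..k}. \<Sum>i\<in>{1..<j}. y e i j) \<le>
        (\<Sum>j\<in>{1..k}. \<Sum>i\<in>{1..<j}. (1 / (2 * real k) + x u i / 2) * (1 / (2 * real k) + x v j / 2))"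
    using feas e uv \<open>2 \<le> k\<close> unfolding lp_feasible_def u_def v_def
    by (intro rounded_less_mass_ge) auto
  also have "\<dots> = (\<Sum>j\<in>{1..k}. \<Sum>i\<in>{1..<j}.
                     prob {\<omega> \<in> space M. L u \<omega> = i} * prob {\<omega> \<in> space M. L v \<omega> = j})"
    using assms(8) uv by (intro sum.cong refl) auto
  also have "\<dots> = prob {\<omega> \<in> space M. L u \<omega> < L v \<omega>}"
    using assms(7) uv by (rule prob_less_indep_vars[symmetric])
  finally show "prob {\<omega> \<in> space M. L (tail D e) \<omega> < L (head D e) \<omega>} \<ge>
      1 / 2 * (\<Sum>(i, j)\<in>{(i, j). i \<in> {1..k} \<and> j \<in> {1..k} \<and> i < j}. y e i j)"
    by (simp only: sum_less_pairs u_def v_def)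
qed

end
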